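(* Let $n\ge 3$, let $m\ge 0$ be an integer, and let $f$ be a measurable function on $\mathbf{R}^{n-1}$ satisfying $$\int_{\mathbf{R}^{n-1}}\frac{|f(y')|}{1+|y'|^{n+m}}\,dy'<\infty .$$ Let $0<\alpha\le n$, and let $v$ be the harmonic function on $H$ defined by $$v(x)=\int_{\mathbf{R}^{n-1}}P_m(x,y')f(y')\,dy',\qquad x\in H .$$ Then there exist a (finite or countably infinite) sequence of points $x_j\in H$ and radii $\rho_j>0$ such that $$\sum_{j}\frac{\rho_j^{\,n-\alpha}}{|x_j|^{\,n-\alpha}}<\infty$$ and, with $G=\bigcup_{j}B(x_j,\rho_j)$, $$v(x)=o\left(x_n^{1-\alpha}|x|^{m+\alpha}\right)\quad\text{as } |x|\to\infty,\ x\in H\setminus G .$$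
   Context: Points of $\mathbf{R}^n$ are written $x=(x',x_n)$ with $x'\in\mathbf{R}^{n-1}$, $x_n\in\mathbf{R}$; $|\cdot|$ is the Euclidean norm and $x\cdot y$ the Euclidean inner product. $H=\{x\in\mathbf{R}^n: x_n>0\}$ is the upper half space, and $\partial H$ is identified with $\mathbf{R}^{n-1}$ via $y'\mapsto(y',0)$. $B(x,\rho)$ is the open ball of centre $x$ and radius $\rho$ in $\mathbf{R}^n$. $\omega_n=2\pi^{n/2}/\Gamma(n/2)$ is the surface area of the unit sphere in $\mathbf{R}^n$. For $\lambda>0$, the Gegenbauer (ultraspherical) polynomials $C_k^\lambda$ are defined by $(1-2tr+r^2)^{-\lambda}=\sum_{k=0}^\infty C_k^\lambda(t)r^k$ for $|r|<1$, $|t|\le1$. The Poisson kernel of $H$ is $P(x,y')=\dfrac{2x_n}{\omega_n|x-(y',0)|^n}$ for $x\in H$, $y'\in\mathbf{R}^{n-1}$. The modified Poisson kernel is $$P_m(x,y')=\begin{cases}P(x,y'), & |y'|\le 1,\\[4pt] P(x,y')-\displaystyle\sum_{k=0}^{m-1}\frac{2x_n|x|^k}{\omega_n|y'|^{n+k}}\,C_k^{n/2}\!\left(\frac{x\cdot(y',0)}{|x||y'|}\right), & |y'|>1,\end{cases}$$ where an empty sum is $0$. *)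

theory Defs
  imports "HOL-Analysis.Analysis" "HOL-Library.Landau_Symbols"
begin

text \<open>
  Points \<open>x = (x', x\<^sub>n)\<close> of \<open>\<real>\<^sup>n\<close> are elements of \<open>(real ^ 'd) \<times> real\<close>, whose norm and inner product
  are the Euclidean ones; thus \<open>n = CARD('d) + 1\<close>, and \<open>\<real>\<^sup>n\<^sup>-\<^sup>1\<close> is \<open>real ^ 'd\<close>.
\<close>

definition upper_half_space :: "((real ^ 'd) \<times> real) set" where
  "upper_half_space = {x. snd x > 0}"

definition sphere_area :: "nat \<Rightarrow> real" where
  "sphere_area n = 2 * pi powr (real n / 2) / Gamma (real n / 2)"

text \<open>
  The coefficient sequence of the generating function; it exists and is unique for \<open>\<bar>t\<bar> \<le> 1\<close>
  (see \<open>gegenbauer_unique\<close> below), and the value is not meaningful for other \<open>t\<close>.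
\<close>

definition gegenbauer :: "real \<Rightarrow> nat \<Rightarrow> real \<Rightarrow> real" where
  "gegenbauer l k t =
     (THE c :: nat \<Rightarrow> real. \<forall>r. \<bar>r\<bar> < 1 \<longrightarrow> (\<lambda>j. c j * r ^ j) sums (1 - 2 * t * r + r\<^sup>2) powr (- l)) k"

lemma gegenbauer_unique:
  fixes l t :: real
  assumes t: "\<bar>t\<bar> \<le> 1"
  shows "\<exists>!c :: nat \<Rightarrow> real. \<forall>r. \<bar>r\<bar> < 1 \<longrightarrow> (\<lambda>j. c j * r ^ j) sums (1 - 2 * t * r + r\<^sup>2) powr (- l)"
proof (rule ex_ex1I)
  define w where "w = Complex t (sqrt (1 - t\<^sup>2))"
  define a where "a j = (complex_of_real (- l) gchoose j) * (- w) ^ j" for j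
  define c where "c k = Re (\<Sum>i\<le>k. a i * cnj (a (k - i)))" for k
  have t2: "t\<^sup>2 \<le> 1"
    using t by (simp add: abs_square_le_1)
  have nw: "norm w = 1"
    using t2 by (simp add: w_def cmod_def)
  have S: "(\<lambda>j. a j * of_real r ^ j) sums (1 - w * of_real r) powr (of_real (- l))"
    if "\<bar>r\<bar> < 1" for r :: real
  proof -
    have "norm (- w * of_real r) < 1"
      using that nw by (simp add: norm_mult)
    from gen_binomial_complex[OF this, of "of_real (- l)"] show ?thesis
      by (simp add: a_def power_mult_distrib[symmetric] mult.assoc)
  qed
  have N: "summable (\<lambda>j. norm (a j * of_real r ^ j))" if r: "\<bar>r\<bar> < 1" for r :: real
  proof -
    obtain s where s: "\<bar>r\<bar> < s" "s < 1"
      using dense[OF r] by blast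
    have "summable (\<lambda>j. a j * of_real s ^ j)"
      using S[of s] s by (auto simp: sums_iff)
    then show ?thesis
      by (rule powser_insidea) (use s in auto)
  qed
  have "(\<lambda>j. c j * r ^ j) sums (1 - 2 * t * r + r\<^sup>2) powr (- l)" if r: "\<bar>r\<bar> < 1" for r
  proof -
    define A where "A = (1 - w * of_real r) powr (of_real (- l))"
    have SA: "(\<lambda>j. a j * of_real r ^ j) sums A"
      using S[OF r] by (simp add: A_def)
    have SB: "(\<lambda>j. cnj (a j * of_real r ^ j)) sums cnj A"
      using SA by (simp only: sums_cnj)
    have "(\<lambda>k. \<Sum>i\<le>k. (a i * of_real r ^ i) * cnj (a (k - i) * of_real r ^ (k - i))) sums (A * cnj A)"
      using Cauchy_product_sums[OF N[OF r], of "\<lambda>j. cnj (a j * of_real r ^ j)"] N[OF r] SA SB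
      by (simp add: sums_iff norm_mult norm_power)
    also have "(\<lambda>k. \<Sum>i\<le>k. (a i * of_real r ^ i) * cnj (a (k - i) * of_real r ^ (k - i))) =
               (\<lambda>k. (\<Sum>i\<le>k. a i * cnj (a (k - i))) * of_real (r ^ k))"
    proof
      fix k
      have "(a i * of_real r ^ i) * cnj (a (k - i) * of_real r ^ (k - i)) =
            a i * cnj (a (k - i)) * of_real (r ^ k)" if "i \<le> k" for i
      proof -
        have "complex_of_real (r ^ k) = of_real r ^ i * of_real r ^ (k - i)"
          using that by (simp flip: power_add)
        then show ?thesis
          by (simp only: complex_cnj_mult complex_cnj_power complex_cnj_complex_of_real mult_ac)
      qed
      then show "(\<Sum>i\<le>k. (a i * of_real r ^ i) * cnj (a (k - i) * of_real r ^ (k - i))) =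
                 (\<Sum>i\<le>k. a i * cnj (a (k - i))) * of_real (r ^ k)"
        unfolding sum_distrib_right by (intro sum.cong) auto
    qed
    finally have "(\<lambda>k. c k * r ^ k) sums Re (A * cnj A)"
      by (auto dest: sums_Re simp: c_def simp del: of_real_power)
    also have "Re (A * cnj A) = (norm A)\<^sup>2"
      by (simp add: complex_norm_square[symmetric] flip: of_real_power)
    also have "norm A = norm (1 - w * of_real r) powr (- l)"
      unfolding A_def by (subst norm_powr_real_powr') auto
    also have "(norm (1 - w * of_real r) powr (- l))\<^sup>2 = ((norm (1 - w * of_real r))\<^sup>2) powr (- l)"
      by (simp add: power2_eq_square powr_mult)
    also have "(norm (1 - w * of_real r))\<^sup>2 = (1 - t * r)\<^sup>2 + (sqrt (1 - t\<^sup>2) * r)\<^sup>2"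
      by (simp add: cmod_power2 w_def)
    also have "\<dots> = 1 - 2 * t * r + r\<^sup>2"
      using t2 by (simp add: power_mult_distrib) (simp add: power2_eq_square algebra_simps)
    finally show ?thesis .
  qed
  then show "\<exists>c :: nat \<Rightarrow> real. \<forall>r. \<bar>r\<bar> < 1 \<longrightarrow>
      (\<lambda>j. c j * r ^ j) sums (1 - 2 * t * r + r\<^sup>2) powr (- l)"
    by blast
next
  fix c d :: "nat \<Rightarrow> real"
  assume c: "\<forall>r. \<bar>r\<bar> < 1 \<longrightarrow> (\<lambda>j. c j * r ^ j) sums (1 - 2 * t * r + r\<^sup>2) powr (- l)"
    and d: "\<forall>r. \<bar>r\<bar> < 1 \<longrightarrow> (\<lambda>j. d j * r ^ j) sums (1 - 2 * t * r + r\<^sup>2) powr (- l)"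
  have z: "(\<lambda>j. (c j - d j) * r ^ j) sums 0" if "\<bar>r\<bar> < 1" for r
    using sums_diff[OF c[rule_format, OF that] d[rule_format, OF that]]
    by (simp add: algebra_simps)
  have "c j - d j = 0" for j
  proof (induction j rule: less_induct)
    case (less k)
    have "(\<lambda>j. (c (j + k) - d (j + k)) * r ^ j) sums 0" if r: "r \<noteq> 0" "norm r < 1" for r :: real
    proof -
      have "(\<lambda>j. (c (j + k) - d (j + k)) * r ^ (j + k)) sums 0"
        using sums_split_initial_segment[OF z, of r k] r less by simp
      then have "(\<lambda>j. r ^ k * ((c (j + k) - d (j + k)) * r ^ j)) sums (r ^ k * 0)"
        by (simp add: power_add mult_ac)
      then show ?thesis
        using r by (subst (asm) sums_mult_iff) auto
    qed
    then have "((\<lambda>_. 0) \<longlongrightarrow> c (0 + k) - d (0 + k)) (at (0::real))"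
      by (intro powser_limit_0_strong[where s = 1 and a = "\<lambda>j. c (j + k) - d (j + k)"]) auto
    then show ?case
      by (auto dest: LIM_const_eq)
  qed
  then show "c = d" by auto
qed

lemma gegenbauer_sums:
  fixes l t r :: real
  assumes "\<bar>t\<bar> \<le> 1" "\<bar>r\<bar> < 1"
  shows "(\<lambda>k. gegenbauer l k t * r ^ k) sums (1 - 2 * t * r + r\<^sup>2) powr (- l)"
  using theI'[OF gegenbauer_unique[OF assms(1), of l]] assms(2)
  unfolding gegenbauer_def by blast

definition poisson_kernel :: "(real ^ 'd) \<times> real \<Rightarrow> real ^ 'd \<Rightarrow> real" where
  "poisson_kernel x y =
     (let n = CARD('d) + 1 in 2 * snd x / (sphere_area n * norm (x - (y, 0)) ^ n))"

definition modified_poisson_kernel :: "nat \<Rightarrow> (real ^ 'd) \<times> real \<Rightarrow> real ^ 'd \<Rightarrow> real" where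
  "modified_poisson_kernel m x y =
     (let n = CARD('d) + 1 in
      if norm y \<le> 1 then poisson_kernel x y
      else poisson_kernel x y -
        (\<Sum>k<m. 2 * snd x * norm x ^ k / (sphere_area n * norm y ^ (n + k)) *
                gegenbauer (real n / 2) k (x \<bullet> (y, 0) / (norm x * norm y))))"

end

theory Submission
  imports Defs
begin

text \<open>
  Write \<open>N = n + m\<close>. The growth condition on \<open>f\<close> says that the measure \<open>M\<close> on the boundary with density
  \<open>\<bar>f y\<bar> / (1 + \<bar>y\<bar> ^ N)\<close> is finite, and \<open>v x\<close> is bounded by the integral of
  \<open>\<bar>P\<^sub>m(x, y)\<bar> (1 + \<bar>y\<bar> ^ N)\<close> against \<open>M\<close>.

  The kernel estimate \<open>modified_poisson_kernel_bound\<close> splits this integrand into two parts. The first is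
  \<open>x\<^sub>n \<bar>x\<bar> ^ m\<close> times a factor that is bounded and tends to \<open>0\<close> pointwise; by dominated convergence it
  contributes \<open>o(x\<^sub>n \<bar>x\<bar> ^ m)\<close>, which is of the required size everywhere in the half space. The gain comes
  from the Gegenbauer expansion of the Poisson kernel, whose coefficients are bounded uniformly in the
  angle (\<open>gegenbauer_expansion_bounds\<close>). The second part is
  \<open>x\<^sub>n \<bar>x\<bar> ^ N\<close> times the integral of \<open>\<bar>x - y\<bar> powr (- n)\<close> over the annulus \<open>\<bar>x\<bar> / 2 < \<bar>y\<bar> \<le> 2 \<bar>x\<bar>\<close>.

  This singular integral is small as soon as no ball around \<open>x\<close> carries too much mass: if the part of
  \<open>M\<close> in the annulus gives every ball \<open>B(x, r)\<close> at most \<open>e (r / \<bar>x\<bar>) powr (n - \<alpha>)\<close>, then summing over the dyadic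
  layers \<open>2 ^ k x\<^sub>n \<le> \<bar>x - y\<bar> < 2 ^ (k + 1) x\<^sub>n\<close> bounds the integral by a multiple of
  \<open>e x\<^sub>n powr (- \<alpha>) \<bar>x\<bar> powr (\<alpha> - n)\<close> (\<open>nn_integral_inverse_power_le_of_growth\<close>), and the second part of \<open>v\<close>
  is at most a multiple of \<open>e x\<^sub>n powr (1 - \<alpha>) \<bar>x\<bar> powr (m + \<alpha>)\<close>.

  The points where the growth condition fails are covered by the Vitali lemma, separately in each
  dyadic shell \<open>2 ^ i \<le> \<bar>x\<bar> < 2 ^ (i + 1)\<close> and with a constant \<open>e i\<close> for that shell
  (\<open>exceptional_balls\<close>). The balls of the shell contribute at most \<open>5 powr (n - \<alpha>)\<close> times
  \<open>M (A i) / e i\<close> to the sum of \<open>(\<rho> / \<bar>x\<bar>) powr (n - \<alpha>)\<close>, where \<open>A i\<close> is a boundary annulus of size about \<open>2 ^ i\<close>.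
  As \<open>M\<close> is finite the masses \<open>M (A i)\<close> are summable, so \<open>e i\<close> can be chosen to tend to \<open>0\<close> so slowly that the
  quotients remain summable (\<open>vanishing_majorant_with_summable_quotients\<close>).
\<close>

section \<open>Uniform bounds for the Gegenbauer expansion\<close>

text \<open>
  For \<open>\<bar>t\<bar> \<le> 1\<close> and \<open>w = t + \<i> sqrt (1 - t\<^sup>2)\<close> one has \<open>\<bar>w\<bar> = 1\<close> and
  \<open>1 - 2 t r + r\<^sup>2 = \<bar>1 - w r\<bar>\<^sup>2\<close>, so the generating function is the product of the binomial series of
  \<open>(1 - w r) powr (- l)\<close> with its complex conjugate.
\<close>
lemma gegenbauer_eq_Cauchy_product:
  fixes l t :: real
  assumes t: "\<bar>t\<bar> \<le> 1"
  defines "w \<equiv> Complex t (sqrt (1 - t\<^sup>2))"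
  defines "a \<equiv> \<lambda>j. (complex_of_real (- l) gchoose j) * (- w) ^ j"
  shows "gegenbauer l k t = Re (\<Sum>i\<le>k. a i * cnj (a (k - i)))"
proof -
  define c where "c k = Re (\<Sum>i\<le>k. a i * cnj (a (k - i)))" for k
  have t2: "t\<^sup>2 \<le> 1" using t by (simp add: abs_square_le_1)
  have nw: "norm w = 1" using t2 by (simp add: w_def cmod_def)
  have S: "(\<lambda>j. a j * of_real r ^ j) sums (1 - w * of_real r) powr (of_real (- l))"
    if "\<bar>r\<bar> < 1" for r :: real
  proof -
    have "norm (- w * of_real r) < 1" using that nw by (simp add: norm_mult)
    from gen_binomial_complex[OF this, of "of_real (- l)"] show ?thesis
      by (simp add: a_def power_mult_distrib[symmetric] mult.assoc)
  qed
  have "(\<lambda>j. c j * r ^ j) sums (1 - 2 * t * r + r\<^sup>2) powr (- l)" if r: "\<bar>r\<bar> < 1" for r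
  proof -
    define A where "A = (1 - w * of_real r) powr (of_real (- l))"
    obtain s where s: "\<bar>r\<bar> < s" "s < 1" using dense[OF r] by blast
    have N: "summable (\<lambda>j. norm (a j * of_real r ^ j))"
      by (rule powser_insidea[OF sums_summable[OF S[of s]]]) (use s in auto)
    have SA: "(\<lambda>j. a j * of_real r ^ j) sums A" using S[OF r] by (simp add: A_def)
    then have SB: "(\<lambda>j. cnj (a j * of_real r ^ j)) sums cnj A" by (simp only: sums_cnj)
    have "(\<lambda>k. \<Sum>i\<le>k. (a i * of_real r ^ i) * cnj (a (k - i) * of_real r ^ (k - i))) sums (A * cnj A)"
      using Cauchy_product_sums[OF N, of "\<lambda>j. cnj (a j * of_real r ^ j)"] N SA SB
      by (simp add: sums_iff norm_mult norm_power)
    also have "(\<lambda>k. \<Sum>i\<le>k. (a i * of_real r ^ i) * cnj (a (k - i) * of_real r ^ (k - i))) =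
               (\<lambda>k. (\<Sum>i\<le>k. a i * cnj (a (k - i))) * of_real (r ^ k))"
      by (auto simp: fun_eq_iff sum_distrib_left sum_distrib_right mult_ac simp flip: power_add intro!: sum.cong)
    finally have "(\<lambda>k. c k * r ^ k) sums Re (A * cnj A)"
      by (auto dest: sums_Re simp: c_def simp del: of_real_power)
    also have "Re (A * cnj A) = (norm A)\<^sup>2"
      by (simp add: complex_norm_square[symmetric] flip: of_real_power)
    also have "norm A = norm (1 - w * of_real r) powr (- l)"
      unfolding A_def by (subst norm_powr_real_powr') auto
    also have "(norm (1 - w * of_real r) powr (- l))\<^sup>2 = ((norm (1 - w * of_real r))\<^sup>2) powr (- l)"
      by (simp add: power2_eq_square powr_mult)
    also have "(norm (1 - w * of_real r))\<^sup>2 = 1 - 2 * t * r + r\<^sup>2"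
      using t2 by (simp add: cmod_power2 w_def power_mult_distrib)
        (simp add: power2_eq_square algebra_simps)
    finally show ?thesis .
  qed
  then have "gegenbauer l k t = c k"
    unfolding gegenbauer_def using the1_equality[OF gegenbauer_unique[OF t, of l], of c] by simp
  then show ?thesis by (simp add: c_def)
qed

text \<open>
  In the product formula \<open>t\<close> enters only through powers of unit complex numbers. Taking absolute
  values therefore gives a bound that does not depend on \<open>t\<close>, and its power series
  converges in the open unit disc, like the binomial series. The point \<open>1/2\<close> is where it is evaluated below.
\<close>
lemma gegenbauer_uniform_majorant:
  fixes l :: real
  obtains d :: "nat \<Rightarrow> real" where "\<And>k t. \<bar>t\<bar> \<le> 1 \<Longrightarrow> \<bar>gegenbauer l k t\<bar> \<le> d k"
    "summable (\<lambda>k. d k * (1/2) ^ k)"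
proof -
  define b where "b j = norm (complex_of_real (- l) gchoose j)" for j
  define d where "d k = (\<Sum>i\<le>k. b i * b (k - i))" for k
  have "\<bar>gegenbauer l k t\<bar> \<le> d k" if t: "\<bar>t\<bar> \<le> 1" for k t
  proof -
    have nw: "cmod (Complex t (sqrt (1 - t\<^sup>2))) = 1"
      using t by (simp add: cmod_def abs_square_le_1)
    show ?thesis
      unfolding gegenbauer_eq_Cauchy_product[OF t] d_def b_def
      by (rule order_trans[OF abs_Re_le_cmod], rule order_trans[OF norm_sum])
        (simp add: norm_mult norm_power nw)
  qed
  moreover have "summable (\<lambda>k. d k * (1/2) ^ k)"
  proof -
    \<comment> \<open>Convergence at the larger point \<open>3/4\<close> gives absolute convergence
      at \<open>1/2\<close>.\<close>
    have "summable (\<lambda>j. (complex_of_real (- l) gchoose j) * (3/4) ^ j)"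
      by (intro sums_summable[OF gen_binomial_complex]) simp
    then have "summable (\<lambda>j. norm ((complex_of_real (- l) gchoose j) * (1/2) ^ j))"
      by (rule powser_insidea) simp
    then have s: "summable (\<lambda>j. b j * (1/2) ^ j)"
      by (simp add: b_def norm_mult norm_power norm_divide)
    have "summable (\<lambda>k. \<Sum>i\<le>k. (b i * (1/2) ^ i) * (b (k - i) * (1/2) ^ (k - i)))"
      using s by (intro summable_Cauchy_product) (simp_all add: b_def)
    also have "(\<lambda>k. \<Sum>i\<le>k. (b i * (1/2) ^ i) * (b (k - i) * (1/2) ^ (k - i))) =
       (\<lambda>k. d k * (1/2) ^ k)"
      unfolding d_def sum_distrib_right
    proof (intro ext sum.cong refl)
      fix k i :: nat assume "i \<in> {..k}"
      then have "(1/2) ^ k = (1/2) ^ i * ((1/2::real) ^ (k - i))" by (simp flip: power_add)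
      then show "b i * (1 / 2) ^ i * (b (k - i) * (1 / 2) ^ (k - i)) = b i * b (k - i) * (1 / 2) ^ k"
        by simp
    qed
    finally show ?thesis .
  qed
  ultimately show ?thesis using that by blast
qed

text \<open>
  Far from the origin of the boundary (\<open>r = \<bar>x\<bar> / \<bar>y\<bar> \<le> 1/2\<close>) the subtracted sum cancels the kernel up to
  order \<open>m\<close>; elsewhere (\<open>r \<ge> 1/2\<close>) the subtracted sum itself is comparable to its last term, of
  order \<open>m - 1\<close>. The latter is written as a quotient so that it also covers the empty sum \<open>m = 0\<close>.
\<close>
lemma gegenbauer_expansion_bounds:
  fixes l :: real
  obtains D where "0 \<le> D"
    "\<And>m t r. \<bar>t\<bar> \<le> 1 \<Longrightarrow> 0 \<le> r \<Longrightarrow> r \<le> 1/2 \<Longrightarrow>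
      \<bar>(1 - 2 * t * r + r\<^sup>2) powr (- l) - (\<Sum>k<m. gegenbauer l k t * r ^ k)\<bar> \<le> D * (2 * r) ^ m"
    "\<And>m t r. \<bar>t\<bar> \<le> 1 \<Longrightarrow> 1/2 \<le> r \<Longrightarrow>
      \<bar>\<Sum>k<m. gegenbauer l k t * r ^ k\<bar> \<le> D * (2 * r) ^ m / (2 * r)"
proof -
  obtain d where d: "\<And>k t. \<bar>t\<bar> \<le> 1 \<Longrightarrow> \<bar>gegenbauer l k t\<bar> \<le> d k"
    and sd: "summable (\<lambda>k. d k * (1/2) ^ k)"
    using gegenbauer_uniform_majorant[of l] by blast
  have d0: "0 \<le> d k" for k
    using d[of 0 k] by (simp add: order_trans[OF abs_ge_zero])
  define D where "D = (\<Sum>k. d k * (1/2) ^ k)"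
  have D0: "0 \<le> D" unfolding D_def by (intro suminf_nonneg sd) (simp add: d0)
  \<comment> \<open>Splitting \<open>r ^ k\<close> as \<open>(2 * r) ^ k * (1/2) ^ k\<close> leaves
    a factor that is monotone in \<open>k\<close>, decreasing for \<open>r \<le> 1/2\<close> and
    increasing for \<open>r \<ge> 1/2\<close>.\<close>
  have summand: "\<bar>gegenbauer l k t * r ^ k\<bar> \<le> B * (d k * (1/2) ^ k)"
    if "\<bar>t\<bar> \<le> 1" "0 \<le> r" "(2 * r) ^ k \<le> B" for t r B k
  proof -
    have "\<bar>gegenbauer l k t * r ^ k\<bar> = \<bar>gegenbauer l k t\<bar> * ((2 * r) ^ k * (1/2) ^ k)"
      using that by (simp add: abs_mult power_mult_distrib power_one_over)
    also have "\<dots> \<le> d k * (B * (1/2) ^ k)"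
      using d[of t k] that by (intro mult_mono mult_right_mono) (auto simp: d0)
    finally show ?thesis by (simp add: mult_ac)
  qed
  have "\<bar>(1 - 2 * t * r + r\<^sup>2) powr (- l) - (\<Sum>k<m. gegenbauer l k t * r ^ k)\<bar> \<le> D * (2 * r) ^ m"
    if t: "\<bar>t\<bar> \<le> 1" and r: "0 \<le> r" "r \<le> 1/2" for m t r
  proof -
    have S: "(\<lambda>k. gegenbauer l k t * r ^ k) sums (1 - 2 * t * r + r\<^sup>2) powr (- l)"
      using r by (intro gegenbauer_sums t) auto
    have S': "(\<lambda>k. gegenbauer l (k + m) t * r ^ (k + m)) sums
        ((1 - 2 * t * r + r\<^sup>2) powr (- l) - (\<Sum>k<m. gegenbauer l k t * r ^ k))"
      using sums_split_initial_segment[OF S] .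
    have le: "norm (gegenbauer l (k + m) t * r ^ (k + m)) \<le> (2 * r) ^ m * (d (k + m) * (1/2) ^ (k + m))" for k
      unfolding real_norm_def using r by (intro summand t power_decreasing) auto
    have sk: "summable (\<lambda>k. d (k + m) * (1/2) ^ (k + m))"
      using sd by (subst summable_iff_shift)
    have "\<bar>(1 - 2 * t * r + r\<^sup>2) powr (- l) - (\<Sum>k<m. gegenbauer l k t * r ^ k)\<bar>
        \<le> (\<Sum>k. (2 * r) ^ m * (d (k + m) * (1/2) ^ (k + m)))"
      unfolding sums_unique[OF S'] real_norm_def[symmetric]
      by (intro norm_suminf_le le summable_mult sk)
    also have "\<dots> = (2 * r) ^ m * (\<Sum>k. d (k + m) * (1/2) ^ (k + m))"
      by (intro suminf_mult sk)
    also have "\<dots> \<le> (2 * r) ^ m * D"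
    proof (intro mult_left_mono)
      have "D = (\<Sum>k. d (k + m) * (1/2) ^ (k + m)) + (\<Sum>k<m. d k * (1/2) ^ k)"
        unfolding D_def by (rule suminf_split_initial_segment[OF sd])
      then show "(\<Sum>k. d (k + m) * (1/2) ^ (k + m)) \<le> D"
        by (simp add: d0 sum_nonneg)
    qed (use r in auto)
    finally show ?thesis by (simp add: mult_ac)
  qed
  moreover have "\<bar>\<Sum>k<m. gegenbauer l k t * r ^ k\<bar> \<le> D * (2 * r) ^ m / (2 * r)"
    if t: "\<bar>t\<bar> \<le> 1" and r: "1/2 \<le> r" for m t r
  proof -
    have "\<bar>\<Sum>k<m. gegenbauer l k t * r ^ k\<bar> \<le> (\<Sum>k<m. \<bar>gegenbauer l k t * r ^ k\<bar>)"
      by (rule sum_abs)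
    also have "\<dots> \<le> (\<Sum>k<m. (2 * r) ^ m / (2 * r) * (d k * (1/2) ^ k))"
    proof (intro sum_mono summand t)
      fix k assume "k \<in> {..<m}"
      then have "(2 * r) ^ Suc k \<le> (2 * r) ^ m"
        using r by (intro power_increasing) auto
      then show "(2 * r) ^ k \<le> (2 * r) ^ m / (2 * r)"
        using r by (simp add: field_simps)
    qed (use r in auto)
    also have "\<dots> = (2 * r) ^ m / (2 * r) * (\<Sum>k<m. d k * (1/2) ^ k)"
      by (simp add: sum_distrib_left)
    also have "\<dots> \<le> (2 * r) ^ m / (2 * r) * D"
      unfolding D_def using r by (intro mult_left_mono sum_le_suminf sd) (auto simp: d0)
    finally show ?thesis by (simp add: mult_ac)
  qed
  ultimately show ?thesis using that[OF D0] by blast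
qed

section \<open>Estimate of the modified Poisson kernel\<close>

lemma sphere_area_pos: "0 < n \<Longrightarrow> 0 < sphere_area n"
  by (simp add: sphere_area_def Gamma_real_pos)

lemma norm_diff_boundary_ge:
  fixes x :: "(real ^ 'd) \<times> real"
  shows "norm x - norm y \<le> norm (x - (y, 0))" "norm y - norm x \<le> norm (x - (y, 0))"
    "\<bar>snd x\<bar> \<le> norm (x - (y, 0))"
  using norm_triangle_ineq2[of x "(y, 0)"] norm_triangle_ineq3[of x "(y, 0)"]
    norm_snd_le[of "snd x" "fst x - y"]
  by (auto simp: norm_Pair minus_prod_def)

text \<open>
  Since \<open>\<bar>x - y\<bar>\<^sup>2 = \<bar>y\<bar>\<^sup>2 (1 - 2 t r + r\<^sup>2)\<close> with \<open>t\<close> the cosine of the angle between \<open>x\<close> and \<open>y\<close>, the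
  Poisson kernel is the Gegenbauer generating function in disguise and the modified kernel subtracts
  a partial sum of its expansion.
\<close>
lemma modified_poisson_kernel_factorization:
  fixes x :: "(real ^ 'd) \<times> real" and y :: "real ^ 'd" and m :: nat
  defines "n \<equiv> CARD('d) + 1"
  defines "t \<equiv> x \<bullet> (y, 0) / (norm x * norm y)" and "r \<equiv> norm x / norm y"
  assumes y: "1 < norm y"
  shows "modified_poisson_kernel m x y = poisson_kernel x y -
      2 * snd x / (sphere_area n * norm y ^ n) * (\<Sum>k<m. gegenbauer (real n / 2) k t * r ^ k)" (is ?A)
    and "norm x < norm y \<Longrightarrow> poisson_kernel x y =
      2 * snd x / (sphere_area n * norm y ^ n) * (1 - 2 * t * r + r\<^sup>2) powr (- (real n / 2))"
      (is "_ \<Longrightarrow> ?B")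
proof -
  show ?A
    using y unfolding modified_poisson_kernel_def Let_def n_def[symmetric] t_def[symmetric] r_def
    by (simp add: sum_distrib_left power_divide power_add mult_ac)
  assume less: "norm x < norm y"
  define q where "q = 1 - 2 * t * r + r\<^sup>2"
  have y0: "norm y \<noteq> 0" using y by linarith
  have tr: "t * r * (norm y)\<^sup>2 = x \<bullet> (y, 0)"
    using y by (cases "x = 0") (auto simp: t_def r_def power2_eq_square)
  have "(norm (x - (y, 0)))\<^sup>2 = (norm x)\<^sup>2 - 2 * (x \<bullet> (y, 0)) + (norm y)\<^sup>2"
    by (simp add: power2_norm_eq_inner inner_diff_left inner_diff_right inner_commute norm_Pair)
  also have "\<dots> = (norm y)\<^sup>2 * q"
    using y0 unfolding q_def tr[symmetric] by (simp add: r_def power_divide algebra_simps)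
  finally have q: "(norm (x - (y, 0)))\<^sup>2 = (norm y)\<^sup>2 * q" .
  have pos: "0 < norm (x - (y, 0))"
    using norm_diff_boundary_ge(2)[of y x] less by linarith
  then have "0 < (norm y)\<^sup>2 * q" by (simp flip: q)
  then have q0: "0 < q" by (simp add: zero_less_mult_iff)
  have "norm (x - (y, 0)) = norm y * sqrt q"
    using arg_cong[OF q, of sqrt] by (simp add: real_sqrt_mult)
  moreover have "sqrt q ^ n = q powr (real n / 2)"
    using q0 by (simp add: powr_half_sqrt[symmetric] powr_powr powr_realpow[symmetric])
  ultimately have "norm (x - (y, 0)) ^ n = norm y ^ n * q powr (real n / 2)"
    by (simp add: power_mult_distrib)
  then show ?B
    unfolding poisson_kernel_def Let_def n_def[symmetric] q_def[symmetric]
    by (simp add: powr_minus field_simps)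
qed

text \<open>
  Integrated against \<open>f\<close>, the first term contributes only \<open>o(x\<^sub>n \<bar>x\<bar> ^ m)\<close>, because its last factor is bounded
  by \<open>1\<close> and tends to \<open>0\<close> as \<open>\<bar>x\<bar> \<rightarrow> \<infinity>\<close>. All singular behaviour sits in the second term, the unmodified
  kernel over the boundary points of size comparable to \<open>\<bar>x\<bar>\<close>. Three sources feed the bound: the
  Poisson kernel for \<open>\<bar>y\<bar> \<le> 2 \<bar>x\<bar>\<close>, the subtracted sum for \<open>1 < \<bar>y\<bar> \<le> 2 \<bar>x\<bar>\<close>, and the remainder of the
  expansion for \<open>\<bar>y\<bar> > 2 \<bar>x\<bar>\<close>.
\<close>
lemma modified_poisson_kernel_bound:
  fixes m :: nat
  defines "n \<equiv> CARD('d) + 1"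
  obtains C where "0 \<le> C"
    "\<And>(x :: (real ^ 'd) \<times> real) y. 0 < snd x \<Longrightarrow> 2 \<le> norm x \<Longrightarrow>
      \<bar>modified_poisson_kernel m x y\<bar> * (1 + norm y ^ (n + m)) \<le>
        C * (snd x * norm x ^ m) * min 1 ((1 + norm y) / norm x) +
        C * (snd x * norm x ^ (n + m)) *
          (if norm x / 2 < norm y \<and> norm y \<le> 2 * norm x then 1 / norm (x - (y, 0)) ^ n else 0)"
proof -
  define s where "s = sphere_area n"
  have s: "0 < s" unfolding s_def by (rule sphere_area_pos) (simp add: n_def)
  obtain D where D: "0 \<le> D"
    "\<And>m t r. \<bar>t\<bar> \<le> 1 \<Longrightarrow> 0 \<le> r \<Longrightarrow> r \<le> 1/2 \<Longrightarrow>
      \<bar>(1 - 2 * t * r + r\<^sup>2) powr (- (real n / 2)) - (\<Sum>k<m. gegenbauer (real n / 2) k t * r ^ k)\<bar>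
        \<le> D * (2 * r) ^ m"
    "\<And>m t r. \<bar>t\<bar> \<le> 1 \<Longrightarrow> 1/2 \<le> r \<Longrightarrow>
      \<bar>\<Sum>k<m. gegenbauer (real n / 2) k t * r ^ k\<bar> \<le> D * (2 * r) ^ m / (2 * r)"
    by (rule gegenbauer_expansion_bounds[of "real n / 2"]) blast
  \<comment> \<open>The constants belong to the Poisson kernel with \<open>\<bar>y\<bar> \<le>
    \<bar>x\<bar> / 2\<close>, the Poisson kernel on the annulus, and the Gegenbauer terms
    (subtracted sum and remainder alike).\<close>
  define C1 C2 C3 where "C1 = 2 / s * 2 ^ n" and "C2 = 2 / s * (1 + 2 ^ (n + m))"
    and "C3 = 4 / s * D * 2 ^ m"
  have C: "0 \<le> C1" "0 \<le> C2" "0 \<le> C3" using s D(1) by (auto simp: C1_def C2_def C3_def)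
  have main: "\<bar>modified_poisson_kernel m x y\<bar> * (1 + norm y ^ (n + m)) \<le>
        (C1 + C3) * (snd x * norm x ^ m) * min 1 ((1 + norm y) / norm x) +
        C2 * (snd x * norm x ^ (n + m)) *
          (if norm x / 2 < norm y \<and> norm y \<le> 2 * norm x then 1 / norm (x - (y, 0)) ^ n else 0)"
    (is "?P * ?w \<le> ?R1 + ?R2")
    if x: "0 < snd x" "2 \<le> norm x" for x :: "(real ^ 'd) \<times> real" and y :: "real ^ 'd"
  proof -
    define R where "R = norm x"
    define z where "z = norm y"
    define p where "p = min 1 ((1 + z) / R)"
    define \<delta> where "\<delta> = norm (x - (y, 0))"
    define u where "u = snd x"
    define K where "K = (if R / 2 < z \<and> z \<le> 2 * R then 1 / \<delta> ^ n else 0)"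
    define t where "t = x \<bullet> (y, 0) / (norm x * norm y)"
    define r where "r = R / z"
    note vars = R_def z_def \<delta>_def u_def
    have R: "2 \<le> R" and z: "0 \<le> z" and u: "0 < u" using x by (auto simp: vars)
    have \<delta>: "0 < \<delta>" using norm_diff_boundary_ge(3)[of x y] x unfolding vars by linarith
    have p: "0 \<le> p" "p \<le> 1" "z / R \<le> 2 * p"  if "z \<le> 2 * R"
      using R z that by (auto simp: p_def min_def field_simps)
    have K: "0 \<le> K" using \<delta> by (simp add: K_def)
    have t: "\<bar>t\<bar> \<le> 1"
    proof -
      have "\<bar>x \<bullet> (y, 0)\<bar> \<le> norm x * norm y"
        using Cauchy_Schwarz_ineq2[of x "(y, 0)"] by (simp add: norm_Pair)
      then show ?thesis
        using divide_right_mono[of _ _ "norm x * norm y"]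
        by (cases "norm x * norm y = 0") (fastforce simp: t_def abs_mult)+
    qed
    have w1: "1 + z ^ (n + m) \<le> 2 * z ^ (n + m)" if "1 < z"
      using that by (simp add: one_le_power)
    have P: "poisson_kernel x y * ?w \<le> C1 * (u * R ^ m) * p + C2 * (u * R ^ (n + m)) * K"
      if z2: "z \<le> 2 * R"
    proof (cases "z \<le> R / 2")
      case True
      have "poisson_kernel x y = 2 * u / (s * \<delta> ^ n)"
        by (simp add: poisson_kernel_def Let_def vars s_def n_def)
      also have "\<dots> \<le> 2 * u / (s * (R / 2) ^ n)"
      proof -
        have "R / 2 \<le> \<delta>" using norm_diff_boundary_ge(1)[of x y] True by (simp add: vars)
        then show ?thesis using s u R
          by (intro divide_left_mono mult_left_mono power_mono mult_pos_pos) (auto simp: \<delta>)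
      qed
      finally have 1: "poisson_kernel x y \<le> C1 * (u / R ^ n)"
        by (simp add: C1_def power_divide mult_ac)
      \<comment> \<open>Trade the weight for \<open>R ^ (n + m)\<close>, keeping a single factor
        \<open>(1 + z) / R \<le> 1\<close> as the gain.\<close>
      have "1 + z ^ (n + m) \<le> (1 + z) ^ (n + m)"
      proof -
        have "z ^ k + 1 \<le> (1 + z) ^ k" if "0 < k" for k
          using that
        proof (induction k rule: nat_induct_non_zero)
          case (Suc k)
          have "z ^ Suc k + 1 \<le> (1 + z) * (z ^ k + 1)" using z by (simp add: algebra_simps)
          also have "\<dots> \<le> (1 + z) * (1 + z) ^ k" using Suc z by (intro mult_left_mono) auto
          finally show ?case by simp
        qed simp
        from this[of "n + m"] show ?thesis by (simp add: n_def add.commute)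
      qed
      also have "\<dots> = R ^ (n + m) * ((1 + z) / R) ^ (n + m)"
        using R by (simp add: power_divide)
      also have "\<dots> \<le> R ^ (n + m) * ((1 + z) / R) ^ 1"
        using R True z by (intro mult_left_mono power_decreasing) (auto simp: n_def)
      also have "((1 + z) / R) ^ 1 = p"
        using R True by (simp add: p_def)
      finally have "poisson_kernel x y * ?w \<le> C1 * (u / R ^ n) * (R ^ (n + m) * p)"
        using 1 z u R C unfolding z_def[symmetric] by (intro mult_mono) auto
      also have "\<dots> = C1 * (u * R ^ m) * p"
        using R by (simp add: power_add)
      also have "\<dots> \<le> \<dots> + C2 * (u * R ^ (n + m)) * K"
        using C u R K by simp
      finally show ?thesis .
    next
      case False
      then have K': "K = 1 / \<delta> ^ n" using z2 by (simp add: K_def)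
      have "1 + z ^ (n + m) \<le> R ^ (n + m) + (2 * R) ^ (n + m)"
        using R z z2 by (intro add_mono one_le_power power_mono) auto
      then have "1 + z ^ (n + m) \<le> R ^ (n + m) * (1 + 2 ^ (n + m))"
        by (simp add: power_mult_distrib algebra_simps)
      then have "2 * u / (s * \<delta> ^ n) * (1 + z ^ (n + m)) \<le>
          2 * u / (s * \<delta> ^ n) * (R ^ (n + m) * (1 + 2 ^ (n + m)))"
        using u s \<delta> by (intro mult_left_mono) auto
      also have "\<dots> = C2 * (u * R ^ (n + m)) * K"
        by (simp add: C2_def K')
      finally have "poisson_kernel x y * ?w \<le> C2 * (u * R ^ (n + m)) * K"
        by (simp add: poisson_kernel_def Let_def vars s_def n_def)
      moreover have "0 \<le> C1 * (u * R ^ m) * p" using C u R p(1)[OF z2] by simp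
      ultimately show ?thesis by linarith
    qed
    have "?P * ?w \<le> (C1 + C3) * (u * R ^ m) * p + C2 * (u * R ^ (n + m)) * K"
    proof (cases "z \<le> 2 * R")
      case z2: True
      have "0 \<le> poisson_kernel x y"
        using x s by (simp add: poisson_kernel_def Let_def s_def n_def)
      then have aP: "\<bar>poisson_kernel x y\<bar> = poisson_kernel x y" by simp
      show ?thesis
      proof (cases "z \<le> 1")
        case True
        then have "?P * ?w = poisson_kernel x y * ?w"
          by (simp add: modified_poisson_kernel_def z_def aP)
        moreover have "0 \<le> C3 * (u * R ^ m) * p" using C u R p(1)[OF z2] by simp
        ultimately show ?thesis using P[OF z2] by (simp add: algebra_simps)
      next
        case False
        then have z1: "1 < z" by simp
        define S where "S = 2 * u / (s * z ^ n) * (\<Sum>k<m. gegenbauer (real n / 2) k t * r ^ k)"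
        have "\<bar>S\<bar> \<le> 2 * u / (s * z ^ n) * (D * (2 * r) ^ m / (2 * r))"
          unfolding S_def abs_mult using z1 u s R z2
          by (intro mult_mono D(3) t) (auto simp: r_def field_simps)
        then have "\<bar>S\<bar> * ?w \<le> 2 * u / (s * z ^ n) * (D * (2 * r) ^ m / (2 * r)) * (2 * z ^ (n + m))"
          using w1[OF z1] z1 u s R D(1) unfolding z_def[symmetric]
          by (intro mult_mono) (auto simp: r_def)
        also have "\<dots> = C3 * (u * R ^ m) * (z / R) / 2"
          using z1 R s by (simp add: r_def C3_def power_divide power_mult_distrib power_add field_simps)
        also have "\<dots> \<le> C3 * (u * R ^ m) * (2 * p) / 2"
          using C u R p(3)[OF z2] by (intro divide_right_mono mult_left_mono) auto
        finally have S: "\<bar>S\<bar> * ?w \<le> C3 * (u * R ^ m) * p" by simp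
        have "modified_poisson_kernel m x y = poisson_kernel x y - S"
          using modified_poisson_kernel_factorization(1)[of y m x] z1
          unfolding S_def s_def n_def vars t_def r_def by simp
        then have "?P \<le> poisson_kernel x y + \<bar>S\<bar>"
          using aP by linarith
        then have "?P * ?w \<le> (poisson_kernel x y + \<bar>S\<bar>) * ?w"
          by (intro mult_right_mono) auto
        then show ?thesis using P[OF z2] S by (simp add: algebra_simps)
      qed
    next
      case False
      then have z1: "1 < z" and r: "0 \<le> r" "r \<le> 1/2" and p1: "p = 1"
        using R by (auto simp: r_def p_def field_simps min_def)
      have less: "norm x < norm y" using False R by (simp add: vars)
      have "modified_poisson_kernel m x y = 2 * u / (s * z ^ n) *
          ((1 - 2 * t * r + r\<^sup>2) powr (- (real n / 2)) - (\<Sum>k<m. gegenbauer (real n / 2) k t * r ^ k))"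
        using modified_poisson_kernel_factorization(1)[of y m x]
          modified_poisson_kernel_factorization(2)[of y x] z1 less
        unfolding s_def n_def vars t_def r_def by (simp add: algebra_simps)
      then have "?P \<le> 2 * u / (s * z ^ n) * (D * (2 * r) ^ m)"
        using z1 u s by (simp only: abs_mult) (intro mult_mono D(2) t r, auto)
      then have "?P * ?w \<le> 2 * u / (s * z ^ n) * (D * (2 * r) ^ m) * (2 * z ^ (n + m))"
        using w1[OF z1] z1 u s R D(1) unfolding z_def[symmetric]
        by (intro mult_mono) (auto simp: r_def)
      also have "\<dots> = C3 * (u * R ^ m) * p"
        using z1 R s by (simp add: p1 r_def C3_def power_divide power_mult_distrib power_add field_simps)
      also have "\<dots> \<le> (C1 + C3) * (u * R ^ m) * p + C2 * (u * R ^ (n + m)) * K"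
        using C u R K p1 by (simp add: algebra_simps)
      finally show ?thesis .
    qed
    then show ?thesis unfolding p_def K_def unfolding vars .
  qed
  show ?thesis
  proof (rule that[of "C1 + C2 + C3"])
    show "0 \<le> C1 + C2 + C3" using C by simp
    fix x :: "(real ^ 'd) \<times> real" and y :: "real ^ 'd"
    assume x: "0 < snd x" "2 \<le> norm x"
    note main[OF x, of y]
    also have "(C1 + C3) * (snd x * norm x ^ m) * min 1 ((1 + norm y) / norm x) \<le>
        (C1 + C2 + C3) * (snd x * norm x ^ m) * min 1 ((1 + norm y) / norm x)"
      using C x by (intro mult_right_mono) auto
    also have "C2 * (snd x * norm x ^ (n + m)) *
          (if norm x / 2 < norm y \<and> norm y \<le> 2 * norm x then 1 / norm (x - (y, 0)) ^ n else 0) \<le>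
        (C1 + C2 + C3) * (snd x * norm x ^ (n + m)) *
          (if norm x / 2 < norm y \<and> norm y \<le> 2 * norm x then 1 / norm (x - (y, 0)) ^ n else 0)"
      using C x by (intro mult_right_mono) auto
    finally show "\<bar>modified_poisson_kernel m x y\<bar> * (1 + norm y ^ (n + m)) \<le>
        (C1 + C2 + C3) * (snd x * norm x ^ m) * min 1 ((1 + norm y) / norm x) +
        (C1 + C2 + C3) * (snd x * norm x ^ (n + m)) *
          (if norm x / 2 < norm y \<and> norm y \<le> 2 * norm x then 1 / norm (x - (y, 0)) ^ n else 0)"
      by simp
  qed
qed

section \<open>Singular integrals under a growth condition\<close>

text \<open>
  The Bochner integral of a function that is not integrable is \<open>0\<close> by convention, so the bound holds
  for every \<open>f\<close>; it can be applied to the modified kernel directly.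
\<close>
lemma norm_integral_le_nn_integral:
  fixes f :: "'a \<Rightarrow> 'b::{banach, second_countable_topology}"
  shows "ennreal (norm (integral\<^sup>L M f)) \<le> (\<integral>\<^sup>+x. ennreal (norm (f x)) \<partial>M)"
  by (cases "integrable M f") (simp_all add: integral_norm_bound_ennreal not_integrable_integral_eq)

text \<open>
  Cut the set into the layers \<open>2 ^ k * u \<le> \<delta> y < 2 ^ (k + 1) * u\<close>. A layer contributes at most
  \<open>(2 ^ k * u) powr (- n)\<close> times the mass of the ball that contains it, which the growth hypothesis
  bounds by a multiple of \<open>(2 ^ k * u) powr (n - \<alpha>)\<close>. What remains is geometric in \<open>k\<close> with ratio \<open>2 powr (- \<alpha>) < 1\<close>.
\<close>
lemma nn_integral_inverse_power_le_of_growth: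
  fixes \<delta> :: "'a \<Rightarrow> real" and n :: nat
  assumes A: "A \<in> sets M" and [measurable]: "\<delta> \<in> borel_measurable M"
    and u: "0 < u" "\<And>y. y \<in> A \<Longrightarrow> u \<le> \<delta> y" and \<alpha>: "0 < \<alpha>" and c: "0 \<le> c"
    and growth: "\<And>r. 0 < r \<Longrightarrow> emeasure M {y\<in>A. \<delta> y < r} \<le> ennreal (c * r powr (real n - \<alpha>))"
  shows "(\<integral>\<^sup>+y. ennreal (1 / \<delta> y ^ n) * indicator A y \<partial>M) \<le>
    ennreal (2 powr (real n - \<alpha>) / (1 - 2 powr - \<alpha>) * (c * u powr - \<alpha>))"
proof -
  define L where "L k = {y\<in>A. \<delta> y < 2 ^ Suc k * u}" for k :: nat
  have L[measurable]: "L k \<in> sets M" for k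
  proof -
    have "L k = A \<inter> {y\<in>space M. \<delta> y < 2 ^ Suc k * u}"
      using sets.sets_into_space[OF A] by (auto simp: L_def)
    also have "\<dots> \<in> sets M" using A by measurable
    finally show ?thesis .
  qed
  have pw: "ennreal (1 / \<delta> y ^ n) * indicator A y \<le>
      (\<Sum>k. ennreal (1 / (2 ^ k * u) ^ n) * indicator (L k) y)" for y
  proof (cases "y \<in> A")
    case True
    obtain k0 where "\<delta> y / u < 2 ^ k0"
      using real_arch_pow[of 2 "\<delta> y / u"] by auto
    also have "(2::real) ^ k0 \<le> 2 ^ Suc k0" by simp
    finally have ex: "\<delta> y < 2 ^ Suc k0 * u" using u by (simp add: field_simps)
    \<comment> \<open>The index of the layer that contains \<open>y\<close>.\<close>
    define k where "k = (LEAST k. \<delta> y < 2 ^ Suc k * u)"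
    have 1: "\<delta> y < 2 ^ Suc k * u"
      unfolding k_def by (rule LeastI[of _ k0]) (rule ex)
    have 2: "2 ^ k * u \<le> \<delta> y"
    proof (cases k)
      case 0
      then show ?thesis using u(2)[OF True] by simp
    next
      case (Suc j)
      then have "\<not> \<delta> y < 2 ^ Suc j * u"
        unfolding k_def using not_less_Least[of j "\<lambda>k. \<delta> y < 2 ^ Suc k * u"] by simp
      then show ?thesis by (simp add: Suc)
    qed
    have "0 < 2 ^ k * u" using u by simp
    then have "1 / \<delta> y ^ n \<le> 1 / (2 ^ k * u) ^ n"
      using 2 by (intro divide_left_mono power_mono mult_pos_pos) auto
    then have "ennreal (1 / \<delta> y ^ n) * indicator A y \<le>
        (\<Sum>k\<in>{k}. ennreal (1 / (2 ^ k * u) ^ n) * indicator (L k) y)"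
      using True 1 by (simp add: L_def ennreal_leI)
    also have "\<dots> \<le> (\<Sum>k. ennreal (1 / (2 ^ k * u) ^ n) * indicator (L k) y)"
      by (intro sum_le_suminf) auto
    finally show ?thesis .
  qed simp
  define q where "q = (2::real) powr - \<alpha>"
  have q: "0 < q" "q < 1" using \<alpha> by (simp_all add: q_def powr_less_one)
  define K where "K = 2 powr (real n - \<alpha>) * (c * u powr - \<alpha>)"
  have K: "0 \<le> K" using c by (simp add: K_def)
  have "(\<integral>\<^sup>+y. ennreal (1 / \<delta> y ^ n) * indicator A y \<partial>M) \<le>
      (\<integral>\<^sup>+y. (\<Sum>k. ennreal (1 / (2 ^ k * u) ^ n) * indicator (L k) y) \<partial>M)"
    by (intro nn_integral_mono pw)
  also have "\<dots> = (\<Sum>k. ennreal (1 / (2 ^ k * u) ^ n) * emeasure M (L k))"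
    by (simp add: nn_integral_suminf nn_integral_cmult)
  also have "\<dots> \<le> (\<Sum>k. ennreal (K * q ^ k))"
  proof (intro suminf_le summableI)
    fix k :: nat
    have "ennreal (1 / (2 ^ k * u) ^ n) * emeasure M (L k) \<le>
        ennreal (1 / (2 ^ k * u) ^ n) * ennreal (c * (2 ^ Suc k * u) powr (real n - \<alpha>))"
      unfolding L_def using u by (intro mult_left_mono growth) auto
    also have "\<dots> = ennreal (1 / (2 ^ k * u) ^ n * (c * (2 ^ Suc k * u) powr (real n - \<alpha>)))"
      using u c by (subst ennreal_mult) auto
    also have "1 / (2 ^ k * u) ^ n * (c * (2 ^ Suc k * u) powr (real n - \<alpha>)) =
        2 powr (real n - \<alpha>) * (c * (2 ^ k * u) powr - \<alpha>)"
    proof -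
      define w where "w = 2 ^ k * u"
      have w: "0 < w" using u by (simp add: w_def)
      have "(2 ^ Suc k * u) powr (real n - \<alpha>) = 2 powr (real n - \<alpha>) * w powr (real n - \<alpha>)"
        using w by (simp add: w_def mult.assoc powr_mult)
      also have "w powr (real n - \<alpha>) = w ^ n * w powr - \<alpha>"
        using w by (simp add: powr_diff powr_minus powr_realpow divide_inverse)
      finally show ?thesis using w unfolding w_def[symmetric] by simp
    qed
    also have "(2 ^ k * u) powr - \<alpha> = u powr - \<alpha> * q ^ k"
      using u by (simp add: q_def powr_mult powr_realpow[symmetric] powr_powr mult.commute)
    finally show "ennreal (1 / (2 ^ k * u) ^ n) * emeasure M (L k) \<le> ennreal (K * q ^ k)"
      by (simp add: K_def mult_ac)
  qed
  also have "\<dots> = ennreal (K * (1 / (1 - q)))"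
    using q K by (intro suminf_ennreal_eq sums_mult geometric_sums) auto
  also have "K * (1 / (1 - q)) = 2 powr (real n - \<alpha>) / (1 - 2 powr - \<alpha>) * (c * u powr - \<alpha>)"
    by (simp add: K_def q_def)
  finally show ?thesis .
qed

section \<open>Exceptional balls\<close>

text \<open>
  A convergent series leaves room to divide its terms by a sequence that still tends to \<open>0\<close>:
  with \<open>T i\<close> the tail sum from \<open>i\<close> on, \<open>(T i - T (i + 1)) / sqrt (T i)\<close> is at most twice the
  telescoping difference \<open>sqrt (T i) - sqrt (T (i + 1))\<close>. The bound \<open>a i \<le> e i\<close> will keep the radii
  of the exceptional balls below the norm of their centres.
\<close>
lemma vanishing_majorant_with_summable_quotients:
  fixes a :: "nat \<Rightarrow> real"
  assumes a: "\<And>i. 0 \<le> a i" and s: "summable a"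
  obtains e where "\<And>i. 0 < e i" "\<And>i. a i \<le> e i" "e \<longlonglongrightarrow> 0" "summable (\<lambda>i. a i / e i)"
proof -
  \<comment> \<open>The geometric summand keeps all tails positive, also where \<open>a\<close>
    vanishes eventually.\<close>
  define b where "b i = a i + (1/2)^i" for i
  have b: "0 < b i" for i
    using a[of i] by (simp add: b_def add_nonneg_pos)
  have sb: "summable b"
    unfolding b_def by (intro summable_add s summable_geometric) simp
  define T where "T i = (\<Sum>k. b (k + i))" for i
  have sT: "summable (\<lambda>k. b (k + i))" for i
    using sb by (simp add: summable_iff_shift)
  have T0: "0 < T i" for i
    unfolding T_def by (intro suminf_pos sT b)
  have TS: "T (Suc i) = T i - b i" for i
    using suminf_split_head[OF sT[of i]] by (simp add: T_def)
  have Tz: "T \<longlonglongrightarrow> 0"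
    unfolding T_def using suminf_exist_split2[OF sb] by simp
  have "decseq T"
    using TS b by (intro decseq_SucI) (simp add: less_imp_le)
  then have TT: "T i \<le> T 0" for i
    by (simp add: decseq_def)
  \<comment> \<open>The factor \<open>sqrt (T 0)\<close> turns \<open>a i \<le> T i\<close> into
    \<open>a i \<le> e i\<close>, because \<open>T i \<le> T 0\<close>.\<close>
  define e where "e i = sqrt (T 0) * sqrt (T i)" for i
  have e: "0 < e i" for i
    using T0 by (simp add: e_def)
  have "a i \<le> e i" for i
  proof -
    have "a i \<le> b i" by (simp add: b_def)
    also have "b i \<le> T i" using TS[of i] T0[of "Suc i"] by linarith
    also have "T i = sqrt (T i) * sqrt (T i)" using T0[of i] by simp
    also have "\<dots> \<le> e i"
      unfolding e_def using TT[of i] T0[of i] by (intro mult_right_mono) auto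
    finally show ?thesis .
  qed
  moreover have "e \<longlonglongrightarrow> 0"
    unfolding e_def using tendsto_mult_left[OF tendsto_real_sqrt[OF Tz], of "sqrt (T 0)"] by simp
  moreover have "summable (\<lambda>i. a i / e i)"
  proof (rule summable_comparison_test')
    show "summable (\<lambda>i. 2 / sqrt (T 0) * (sqrt (T i) - sqrt (T (Suc i))))"
      using telescope_summable'[OF tendsto_real_sqrt[OF Tz]] by (intro summable_mult)
    fix i :: nat
    have le: "sqrt (T (Suc i)) \<le> sqrt (T i)"
      using TS[of i] b[of i] by simp
    have "a i \<le> b i" by (simp add: b_def)
    also have "b i = (sqrt (T i) - sqrt (T (Suc i))) * (sqrt (T i) + sqrt (T (Suc i)))"
      using TS[of i] T0[of i] T0[of "Suc i"] by (simp add: algebra_simps)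
    also have "\<dots> \<le> (sqrt (T i) - sqrt (T (Suc i))) * (2 * sqrt (T i))"
      using le by (intro mult_left_mono) auto
    finally have "a i / e i \<le> (sqrt (T i) - sqrt (T (Suc i))) * (2 * sqrt (T i)) / e i"
      using e[of i] by (simp add: divide_right_mono)
    also have "\<dots> = 2 / sqrt (T 0) * (sqrt (T i) - sqrt (T (Suc i)))"
      using T0[of i] T0[of 0] by (simp add: e_def field_simps)
    finally show "norm (a i / e i) \<le> 2 / sqrt (T 0) * (sqrt (T i) - sqrt (T (Suc i)))"
      using a[of i] e[of i] by simp
  qed
  ultimately show ?thesis using that e by blast
qed

text \<open>
  A point \<open>x\<close> is bad if some ball around it carries more mass than the growth condition allows. The
  Vitali lemma selects disjoint balls among these whose fivefold enlargements cover all bad points;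
  each selected ball pays for \<open>(r / \<bar>x\<bar>) powr \<beta>\<close> with its mass divided by \<open>e\<close>, and disjointness
  bounds the total mass by that of \<open>A\<close>. When \<open>\<beta> = 0\<close> the bound on the mass of \<open>A\<close> leaves no bad points at all.
\<close>
lemma exceptional_balls:
  fixes \<phi> :: "'a \<Rightarrow> 'b::euclidean_space" and \<beta> :: real
  assumes "finite_measure M" and \<phi>[measurable]: "\<phi> \<in> borel_measurable M" and A: "A \<in> sets M"
    and e: "0 < e" "measure M A \<le> e" and \<beta>: "0 \<le> \<beta>"
    and S: "\<And>x. x \<in> S \<Longrightarrow> 0 < norm x \<and> norm x \<le> B"
  obtains C \<rho> where "countable C" "C \<subseteq> S" "\<And>x. x \<in> C \<Longrightarrow> 0 < \<rho> x"
    "\<And>F. finite F \<Longrightarrow> F \<subseteq> C \<Longrightarrow>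
      (\<Sum>x\<in>F. \<rho> x powr \<beta> / norm x powr \<beta>) \<le> 5 powr \<beta> * (measure M A / e)"
    "\<And>x r. x \<in> S \<Longrightarrow> x \<notin> (\<Union>c\<in>C. ball c (\<rho> c)) \<Longrightarrow> 0 < r \<Longrightarrow>
      measure M {y\<in>A. dist x (\<phi> y) < r} \<le> e * (r / norm x) powr \<beta>"
proof -
  interpret finite_measure M by fact
  define Q where "Q x r = {y\<in>A. dist x (\<phi> y) < r}" for x r
  have Q: "Q x r \<in> sets M" for x r
  proof -
    have "Q x r = A \<inter> {y\<in>space M. dist x (\<phi> y) < r}"
      using sets.sets_into_space[OF A] by (auto simp: Q_def)
    also have "\<dots> \<in> sets M" using A by measurable
    finally show ?thesis .
  qed
  define E where "E = {x\<in>S. \<exists>r>0. e * (r / norm x) powr \<beta> < measure M (Q x r)}"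
  define R where "R x = (SOME r. 0 < r \<and> e * (r / norm x) powr \<beta> < measure M (Q x r))" for x
  have R: "0 < R x" "e * (R x / norm x) powr \<beta> < measure M (Q x (R x))" if "x \<in> E" for x
    using someI_ex[of "\<lambda>r. 0 < r \<and> e * (r / norm x) powr \<beta> < measure M (Q x r)"] that
    unfolding E_def R_def by blast+
  \<comment> \<open>The Vitali lemma needs bounded radii: a ball of radius at least
    \<open>\<bar>x\<bar>\<close> would have to carry more mass than \<open>e\<close>, hence more
    than all of \<open>A\<close>.\<close>
  have RB: "R x \<le> B" if x: "x \<in> E" for x
  proof (rule ccontr)
    assume "\<not> R x \<le> B"
    moreover have xS: "0 < norm x" "norm x \<le> B" using S[of x] x by (auto simp: E_def)
    ultimately have "1 \<le> R x / norm x" by simp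
    then have "1 \<le> (R x / norm x) powr \<beta>" using \<beta> by (rule ge_one_powr_ge_zero)
    then have "e \<le> e * (R x / norm x) powr \<beta>" using e by simp
    also note R(2)[OF x]
    also have "measure M (Q x (R x)) \<le> measure M A"
      by (rule finite_measure_mono[OF _ A]) (auto simp: Q_def)
    finally show False using e by simp
  qed
  have cov: "E \<subseteq> (\<Union>x\<in>E. ball x (R x))" using R(1) by force
  obtain C where C: "countable C" "C \<subseteq> E"
    and disj: "pairwise (\<lambda>i j. disjnt (ball i (R i)) (ball j (R j))) C"
    and EC: "E \<subseteq> (\<Union>i\<in>C. ball i (5 * R i))"
    by (rule Vitali_covering_lemma_balls[OF cov, of B]) (use R(1) RB in auto)
  show ?thesis
  proof (rule that[of C "\<lambda>x. 5 * R x"])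
    show "countable C" "C \<subseteq> S" using C by (auto simp: E_def)
    show "0 < 5 * R x" if "x \<in> C" for x using that C R(1)[of x] by auto
  next
    fix F assume F: "finite F" "F \<subseteq> C"
    have "(\<Sum>x\<in>F. (5 * R x) powr \<beta> / norm x powr \<beta>) \<le> (\<Sum>x\<in>F. 5 powr \<beta> * (measure M (Q x (R x)) / e))"
    proof (rule sum_mono)
      fix x assume "x \<in> F"
      then have x: "x \<in> E" using F C by auto
      have "(5 * R x) powr \<beta> / norm x powr \<beta> = 5 powr \<beta> * (R x / norm x) powr \<beta>"
        using R(1)[OF x] by (simp add: powr_mult powr_divide)
      also have "\<dots> \<le> 5 powr \<beta> * (measure M (Q x (R x)) / e)"
        using R(2)[OF x] e by (intro mult_left_mono) (auto simp: field_simps)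
      finally show "(5 * R x) powr \<beta> / norm x powr \<beta> \<le> 5 powr \<beta> * (measure M (Q x (R x)) / e)" .
    qed
    also have "\<dots> = 5 powr \<beta> * ((\<Sum>x\<in>F. measure M (Q x (R x))) / e)"
      by (simp add: sum_distrib_left sum_divide_distrib)
    also have "(\<Sum>x\<in>F. measure M (Q x (R x))) = measure M (\<Union>x\<in>F. Q x (R x))"
    proof (rule finite_measure_finite_Union[symmetric])
      show "disjoint_family_on (\<lambda>x. Q x (R x)) F"
        using disj F(2) unfolding disjoint_family_on_def pairwise_def disjnt_def Q_def
        by (auto simp: disjoint_iff)
    qed (use F Q in auto)
    also have "\<dots> \<le> measure M A"
      by (rule finite_measure_mono[OF _ A]) (auto simp: Q_def)
    finally show "(\<Sum>x\<in>F. (5 * R x) powr \<beta> / norm x powr \<beta>) \<le> 5 powr \<beta> * (measure M A / e)"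
      using e by (simp add: divide_right_mono mult_left_mono)
  next
    fix x r assume "x \<in> S" "x \<notin> (\<Union>c\<in>C. ball c (5 * R c))" "0 < (r::real)"
    then show "measure M {y\<in>A. dist x (\<phi> y) < r} \<le> e * (r / norm x) powr \<beta>"
      using EC unfolding E_def Q_def by (force simp: not_less)
  qed
qed

text \<open>
  Merges the coverings found for the individual dyadic shells into one sequence. The union is kept
  disjoint, as a set of pairs, because the same centre may occur in several families with different radii.
\<close>
lemma enumerate_countable_families:
  fixes C :: "nat \<Rightarrow> 'b set" and w :: "nat \<Rightarrow> 'b \<Rightarrow> real"
  assumes C: "\<And>i. countable (C i)" and w: "\<And>i x. x \<in> C i \<Longrightarrow> 0 \<le> w i x"
    and b: "\<And>i F. finite F \<Longrightarrow> F \<subseteq> C i \<Longrightarrow> sum (w i) F \<le> b i" and sb: "summable b"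
  obtains J :: "nat set" and p where "p ` J = Sigma UNIV C"
    "(\<lambda>j. w (fst (p j)) (snd (p j))) summable_on J"
proof -
  define D where "D = Sigma UNIV C"
  have D: "countable D" unfolding D_def using C by auto
  have b0: "0 \<le> b i" for i using b[of "{}" i] by simp
  have "(\<lambda>z. w (fst z) (snd z)) summable_on D"
  proof (rule nonneg_bdd_above_summable_on)
    show "0 \<le> w (fst z) (snd z)" if "z \<in> D" for z using that w by (auto simp: D_def)
    show "bdd_above (sum (\<lambda>z. w (fst z) (snd z)) ` {F. F \<subseteq> D \<and> finite F})"
    proof (rule bdd_aboveI2[of _ _ "suminf b"], clarify)
      fix F assume F: "F \<subseteq> D" "finite F"
      define G where "G i = {x. (i, x) \<in> F}" for i
      have G: "finite (G i)" for i
        using finite_vimageI[OF F(2), of "Pair i"] by (simp add: G_def vimage_def inj_on_def)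
      have FG: "F = Sigma (fst ` F) G" by (force simp: G_def)
      have "(\<Sum>z\<in>F. w (fst z) (snd z)) = (\<Sum>i\<in>fst ` F. \<Sum>x\<in>G i. w i x)"
        by (subst FG, subst sum.Sigma) (use F G in \<open>auto simp: case_prod_unfold\<close>)
      also have "\<dots> \<le> (\<Sum>i\<in>fst ` F. b i)"
        by (intro sum_mono b G) (use F in \<open>auto simp: G_def D_def\<close>)
      also have "\<dots> \<le> suminf b"
        using F b0 sb by (intro sum_le_suminf) auto
      finally show "(\<Sum>z\<in>F. w (fst z) (snd z)) \<le> suminf b" .
    qed
  qed
  define J where "J = to_nat_on D ` D"
  define p where "p = inv_into D (to_nat_on D)"
  have inj: "inj_on (to_nat_on D) D" by (rule inj_on_to_nat_on[OF D])
  have bij: "bij_betw p J D"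
    unfolding p_def J_def using inj by (intro bij_betw_inv_into inj_on_imp_bij_betw)
  show ?thesis
  proof (rule that[of p J])
    show "p ` J = Sigma UNIV C" using bij by (simp add: bij_betw_def D_def)
    show "(\<lambda>j. w (fst (p j)) (snd (p j))) summable_on J"
      using summable_on_reindex_bij_betw[OF bij, of "\<lambda>z. w (fst z) (snd z)"]
        \<open>(\<lambda>z. w (fst z) (snd z)) summable_on D\<close> by simp
  qed
qed

section \<open>Finite measures and dyadic scales\<close>

text \<open>
  Each of these annuli has ratio \<open>8\<close>, hence is made of three consecutive members of the disjoint family
  \<open>2 ^ k / 2 < g y \<le> 2 ^ k\<close>.
\<close>
lemma (in finite_measure) summable_measure_dyadic_annuli:
  fixes g :: "'a \<Rightarrow> real"
  assumes g[measurable]: "g \<in> borel_measurable M"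
  shows "summable (\<lambda>i. measure M {y\<in>space M. 2 ^ i / 2 < g y \<and> g y \<le> 2 * 2 ^ Suc i})"
proof -
  define b where "b k = {y\<in>space M. 2 ^ k / 2 < g y \<and> g y \<le> 2 ^ k}" for k :: nat
  have b: "b k \<in> sets M" for k unfolding b_def by measurable
  have "b j \<inter> b k = {}" if "j < k" for j k
  proof -
    have "(2::real) ^ Suc j \<le> 2 ^ k" using that by (intro power_increasing) auto
    then show ?thesis by (auto simp: b_def)
  qed
  then have "disjoint_family b"
    unfolding disjoint_family_on_def by (metis Int_commute nat_neq_iff)
  then have s: "summable (\<lambda>k. measure M (b k))"
    using finite_measure_UNION[of b] b by (auto simp: sums_iff)
  show ?thesis
  proof (rule summable_comparison_test')
    show "summable (\<lambda>i. measure M (b i) + measure M (b (i + 1)) + measure M (b (i + 2)))"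
      using s summable_iff_shift[of "\<lambda>k. measure M (b k)" 1]
        summable_iff_shift[of "\<lambda>k. measure M (b k)" 2]
      by (intro summable_add) auto
    fix i :: nat
    have "measure M {y\<in>space M. 2 ^ i / 2 < g y \<and> g y \<le> 2 * 2 ^ Suc i} \<le>
        measure M (b i \<union> b (i + 1) \<union> b (i + 2))"
      using b by (intro finite_measure_mono) (auto simp: b_def)
    also have "\<dots> \<le> measure M (b i) + measure M (b (i + 1)) + measure M (b (i + 2))"
      using measure_Un_le[of "b i \<union> b (i + 1)" M "b (i + 2)"] measure_Un_le[of "b i" M "b (i + 1)"] b
      by auto
    finally show "norm (measure M {y\<in>space M. 2 ^ i / 2 < g y \<and> g y \<le> 2 * 2 ^ Suc i}) \<le>
        measure M (b i) + measure M (b (i + 1)) + measure M (b (i + 2))" by simp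
  qed
qed

lemma (in finite_measure) integral_min_dilation_tendsto_0:
  fixes g :: "'a \<Rightarrow> real"
  assumes g[measurable]: "g \<in> borel_measurable M" and g0: "\<And>y. 0 \<le> g y"
  shows "(\<lambda>i. \<integral>y. min 1 ((1 + g y) / 2 ^ i) \<partial>M) \<longlonglongrightarrow> 0"
proof -
  have "(\<lambda>i. \<integral>y. min 1 ((1 + g y) / 2 ^ i) \<partial>M) \<longlonglongrightarrow> (\<integral>y. 0 \<partial>M)"
  proof (rule integral_dominated_convergence[where w = "\<lambda>_. 1"])
    show "AE y in M. (\<lambda>i. min 1 ((1 + g y) / 2 ^ i)) \<longlonglongrightarrow> 0"
    proof (rule AE_I2)
      fix y
      have "(\<lambda>i. (1 + g y) * (1 / 2) ^ i) \<longlonglongrightarrow> (1 + g y) * 0"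
        by (intro tendsto_mult_left LIMSEQ_power_zero) simp
      then have "(\<lambda>i. (1 + g y) / 2 ^ i) \<longlonglongrightarrow> 0"
        by (simp only: power_one_over mult_zero_right times_divide_eq_right mult_1_right)
      then have "(\<lambda>i. min 1 ((1 + g y) / 2 ^ i)) \<longlonglongrightarrow> min 1 0"
        by (intro tendsto_min tendsto_const)
      then show "(\<lambda>i. min 1 ((1 + g y) / 2 ^ i)) \<longlonglongrightarrow> 0" by simp
    qed
    show "AE y in M. norm (min 1 ((1 + g y) / 2 ^ i)) \<le> 1" for i
      using g0 by (intro AE_I2) (auto simp: min_def)
  qed auto
  then show ?thesis by simp
qed

section \<open>Growth of the modified Poisson integral\<close>

lemma borel_measurable_lebesgue_continuous:
  fixes g :: "'a::euclidean_space \<Rightarrow> 'b::topological_space"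
  assumes "continuous_on UNIV g"
  shows "g \<in> borel_measurable lebesgue"
  using borel_measurable_continuous_onI[OF assms] by (intro measurable_completion) simp

lemma borel_measurable_polynomial_weight:
  fixes f :: "'a::euclidean_space \<Rightarrow> real"
  assumes f[measurable]: "f \<in> borel_measurable lebesgue"
  shows "(\<lambda>y. ennreal (\<bar>f y\<bar> / (1 + norm y ^ N))) \<in> borel_measurable lebesgue"
proof -
  have [measurable]: "(\<lambda>y::'a. 1 + norm y ^ N) \<in> borel_measurable lebesgue"
    by (intro borel_measurable_lebesgue_continuous continuous_intros)
  show ?thesis by measurable
qed

text \<open>
  Transfers a pointwise bound of a kernel, weighted by \<open>1 + \<bar>y\<bar> ^ N\<close>, to its integral against \<open>f\<close>; the
  growth hypothesis on \<open>f\<close> says precisely that the measure \<open>M\<close> is finite.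
\<close>
lemma boundary_integral_bound:
  fixes f :: "real ^ 'd \<Rightarrow> real" and k :: "real ^ 'd \<Rightarrow> real" and N n :: nat
  assumes f: "f \<in> borel_measurable lebesgue"
  defines "M \<equiv> density lebesgue (\<lambda>y. ennreal (\<bar>f y\<bar> / (1 + norm y ^ N)))"
  assumes fin: "finite_measure M"
    and A: "A \<in> sets lebesgue" and b: "b \<in> borel_measurable lebesgue" "\<And>y. 0 \<le> b y" "\<And>y. b y \<le> 1"
    and g: "g \<in> borel_measurable lebesgue" "\<And>y. 0 \<le> g y"
    and c: "0 \<le> c1" "0 \<le> c2"
    and k: "\<And>y. \<bar>k y\<bar> * (1 + norm y ^ N) \<le> c1 * b y + c2 * (g y * indicator A y)"
    and T: "(\<integral>\<^sup>+y. ennreal (g y) * indicator A y \<partial>M) \<le> ennreal T" "0 \<le> T"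
  shows "\<bar>\<integral>y. k y * f y \<partial>lebesgue\<bar> \<le> c1 * (\<integral>y. b y \<partial>M) + c2 * T"
proof -
  interpret finite_measure M by fact
  have h: "(\<lambda>y. ennreal (\<bar>f y\<bar> / (1 + norm y ^ N))) \<in> borel_measurable lebesgue"
    by (rule borel_measurable_polynomial_weight[OF f])
  have bM[measurable]: "b \<in> borel_measurable M" and gM[measurable]: "g \<in> borel_measurable M"
    and AM[measurable]: "A \<in> sets M"
    using b g A by (simp_all add: M_def)
  have int_b: "integrable M b"
    using b by (intro integrable_const_bound[where B = 1]) auto
  have "ennreal \<bar>\<integral>y. k y * f y \<partial>lebesgue\<bar> \<le> (\<integral>\<^sup>+y. ennreal (norm (k y * f y)) \<partial>lebesgue)"
    using norm_integral_le_nn_integral[of lebesgue "\<lambda>y. k y * f y"] by simp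
  also have "\<dots> \<le> (\<integral>\<^sup>+y. ennreal (\<bar>f y\<bar> / (1 + norm y ^ N)) *
      (ennreal (c1 * b y) + ennreal c2 * (ennreal (g y) * indicator A y)) \<partial>lebesgue)"
  proof (intro nn_integral_mono)
    fix y :: "real ^ 'd"
    have pos: "0 < 1 + norm y ^ N" by (simp add: add_pos_nonneg)
    have "norm (k y * f y) = \<bar>f y\<bar> / (1 + norm y ^ N) * (\<bar>k y\<bar> * (1 + norm y ^ N))"
      using pos by (simp add: abs_mult)
    also have "\<dots> \<le> \<bar>f y\<bar> / (1 + norm y ^ N) * (c1 * b y + c2 * (g y * indicator A y))"
      using pos by (intro mult_left_mono k) auto
    finally have "ennreal (norm (k y * f y)) \<le>
        ennreal (\<bar>f y\<bar> / (1 + norm y ^ N) * (c1 * b y + c2 * (g y * indicator A y)))"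
      by (rule ennreal_leI)
    also have "\<dots> = ennreal (\<bar>f y\<bar> / (1 + norm y ^ N)) *
      (ennreal (c1 * b y) + ennreal c2 * (ennreal (g y) * indicator A y))"
      using pos b(2) g(2) c
      by (cases "y \<in> A"; subst ennreal_mult) (auto simp: ennreal_mult ennreal_plus)
    finally show "ennreal (norm (k y * f y)) \<le> \<dots>" .
  qed
  also have "\<dots> = (\<integral>\<^sup>+y. (ennreal (c1 * b y) + ennreal c2 * (ennreal (g y) * indicator A y)) \<partial>M)"
    unfolding M_def by (rule nn_integral_density[symmetric, OF h]) (use b g A in measurable)
  also have "\<dots> = (\<integral>\<^sup>+y. ennreal (c1 * b y) \<partial>M) +
      ennreal c2 * (\<integral>\<^sup>+y. ennreal (g y) * indicator A y \<partial>M)"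
    by (simp add: nn_integral_add nn_integral_cmult)
  also have "\<dots> \<le> ennreal (c1 * (\<integral>y. b y \<partial>M)) + ennreal c2 * ennreal T"
    using int_b b c T
    by (intro add_mono mult_left_mono) (simp_all add: nn_integral_eq_integral)
  also have "\<dots> = ennreal (c1 * (\<integral>y. b y \<partial>M) + c2 * T)"
    using c T b by (simp add: ennreal_mult ennreal_plus integral_nonneg_AE)
  finally show ?thesis
    using c T b by (subst (asm) ennreal_le_iff) (auto intro!: add_nonneg_nonneg mult_nonneg_nonneg integral_nonneg_AE)
qed

theorem theorem1:
  fixes f :: "real ^ 'd \<Rightarrow> real" and v :: "(real ^ 'd) \<times> real \<Rightarrow> real"
    and n m :: nat and \<alpha> :: real
  assumes dim: "n = CARD('d) + 1" and n: "n \<ge> 3"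
    and meas: "f \<in> borel_measurable lebesgue"
    and fin: "(\<integral>\<^sup>+ y. ennreal (\<bar>f y\<bar> / (1 + norm y ^ (n + m))) \<partial>lebesgue) < \<infinity>"
    and \<alpha>: "0 < \<alpha>" "\<alpha> \<le> real n"
    and v: "\<And>x. x \<in> upper_half_space \<Longrightarrow>
              v x = (\<integral>y. modified_poisson_kernel m x y * f y \<partial>lebesgue)"
  shows "\<exists>(J :: nat set) (X :: nat \<Rightarrow> (real ^ 'd) \<times> real) (\<rho> :: nat \<Rightarrow> real).
           (\<forall>j\<in>J. X j \<in> upper_half_space \<and> \<rho> j > 0) \<and>
           (\<lambda>j. \<rho> j powr (real n - \<alpha>) / norm (X j) powr (real n - \<alpha>)) summable_on J \<and>
           v \<in> o[inf at_infinity (principal (upper_half_space - (\<Union>j\<in>J. ball (X j) (\<rho> j))))](\<lambda>x.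
             snd x powr (1 - \<alpha>) * norm x powr (real m + \<alpha>))"
proof -
  define \<beta> where "\<beta> = real n - \<alpha>"
  define M where "M = density lebesgue (\<lambda>y. ennreal (\<bar>f y\<bar> / (1 + norm y ^ (n + m))))"
  \<comment> \<open>The annulus \<open>A i\<close> contains \<open>{y. \<bar>x\<bar> / 2 <
    \<bar>y\<bar> \<and> \<bar>y\<bar> \<le> 2 * \<bar>x\<bar>}\<close> for all \<open>x\<close> in
    the shell \<open>S i\<close>, so one measure serves a whole shell.\<close>
  define A :: "nat \<Rightarrow> (real ^ 'd) set"
    where "A i = {y\<in>space M. 2 ^ i / 2 < norm y \<and> norm y \<le> 2 * 2 ^ Suc i}" for i
  define S :: "nat \<Rightarrow> ((real ^ 'd) \<times> real) set"
    where "S i = {x\<in>upper_half_space. 2 ^ i \<le> norm x \<and> norm x < 2 ^ Suc i}" for i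
  define \<phi> where "\<phi> y = (y, 0::real)" for y :: "real ^ 'd"
  have \<beta>: "0 \<le> \<beta>" using \<alpha> by (simp add: \<beta>_def)
  have norm_meas: "norm \<in> borel_measurable M"
    unfolding M_def measurable_density_eq1 by (intro borel_measurable_lebesgue_continuous continuous_intros)
  have \<phi>_meas: "\<phi> \<in> borel_measurable M"
    unfolding M_def \<phi>_def measurable_density_eq1 by (intro borel_measurable_lebesgue_continuous continuous_intros)
  have "(\<lambda>y. ennreal (\<bar>f y\<bar> / (1 + norm y ^ (n + m)))) \<in> borel_measurable lebesgue"
    by (rule borel_measurable_polynomial_weight[OF meas])
  then have finite_M: "finite_measure M"
    using fin by (intro finite_measureI) (simp add: M_def emeasure_density)
  then interpret finite_measure M .
  have A: "A i \<in> sets M" for i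
    unfolding A_def using norm_meas by measurable
  obtain e where e: "\<And>i. 0 < e i" "\<And>i. measure M (A i) \<le> e i" "e \<longlonglongrightarrow> 0"
    and e_sum: "summable (\<lambda>i. measure M (A i) / e i)"
    by (rule vanishing_majorant_with_summable_quotients[of "\<lambda>i. measure M (A i)"])
      (use summable_measure_dyadic_annuli[OF norm_meas] in \<open>auto simp: A_def\<close>)
  \<comment> \<open>\<open>exc i C \<rho>\<close>: outside the balls with centres in
    \<open>C\<close> and radii \<open>\<rho>\<close>, the mass of \<open>A i\<close> grows as
    required around every point of the shell, and these balls are few.\<close>
  define exc where "exc i C \<rho> \<longleftrightarrow> countable C \<and> C \<subseteq> S i \<and> (\<forall>x\<in>C. 0 < \<rho> x) \<and>
      (\<forall>F. finite F \<longrightarrow> F \<subseteq> C \<longrightarrow>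
        (\<Sum>x\<in>F. \<rho> x powr \<beta> / norm x powr \<beta>) \<le> 5 powr \<beta> * (measure M (A i) / e i)) \<and>
      (\<forall>x r. x \<in> S i \<longrightarrow> x \<notin> (\<Union>c\<in>C. ball c (\<rho> c)) \<longrightarrow> 0 < r \<longrightarrow>
        measure M {y\<in>A i. dist x (\<phi> y) < r} \<le> e i * (r / norm x) powr \<beta>)" for i C \<rho>
  have "\<exists>C \<rho>. exc i C \<rho>" for i
  proof -
    have S: "0 < norm x \<and> norm x \<le> 2 ^ Suc i" if "x \<in> S i" for x
    proof -
      have "(0::real) < 2 ^ i" by simp
      also have "\<dots> \<le> norm x" using that by (simp add: S_def)
      finally show ?thesis using that by (simp add: S_def)
    qed
    show ?thesis
      unfolding exc_def
      by (rule exceptional_balls[OF finite_M \<phi>_meas A[of i] e(1)[of i] e(2)[of i] \<beta> S])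
        (assumption, blast)
  qed
  then obtain C \<rho>0 where exc: "\<And>i. exc i (C i) (\<rho>0 i)" by metis
  have C: "countable (C i)" "C i \<subseteq> S i" "x \<in> C i \<Longrightarrow> 0 < \<rho>0 i x"
    and C_sum: "finite F \<Longrightarrow> F \<subseteq> C i \<Longrightarrow>
        (\<Sum>x\<in>F. \<rho>0 i x powr \<beta> / norm x powr \<beta>) \<le> 5 powr \<beta> * (measure M (A i) / e i)"
    and growth: "x \<in> S i \<Longrightarrow> x \<notin> (\<Union>c\<in>C i. ball c (\<rho>0 i c)) \<Longrightarrow> 0 < r \<Longrightarrow>
        measure M {y\<in>A i. dist x (\<phi> y) < r} \<le> e i * (r / norm x) powr \<beta>" for i x r F
    using exc[of i] unfolding exc_def by blast+
  obtain J :: "nat set" and p where p: "p ` J = Sigma UNIV C"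
    and J_sum: "(\<lambda>j. \<rho>0 (fst (p j)) (snd (p j)) powr \<beta> / norm (snd (p j)) powr \<beta>) summable_on J"
  proof (rule enumerate_countable_families)
    show "countable (C i)" for i by (rule C(1))
    show "0 \<le> \<rho>0 i x powr \<beta> / norm x powr \<beta>" for i x by simp
    show "(\<Sum>x\<in>F. \<rho>0 i x powr \<beta> / norm x powr \<beta>) \<le> 5 powr \<beta> * (measure M (A i) / e i)"
      if "finite F" "F \<subseteq> C i" for i F
      using that by (rule C_sum)
    show "summable (\<lambda>i. 5 powr \<beta> * (measure M (A i) / e i))"
      by (intro summable_mult e_sum)
  qed
  define X where "X j = snd (p j)" for j
  define \<rho> where "\<rho> j = \<rho>0 (fst (p j)) (snd (p j))" for j
  have pC: "snd (p j) \<in> C (fst (p j))" if "j \<in> J" for j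
    using imageI[OF that, of p] unfolding p by auto
  define G where "G = (\<Union>j\<in>J. ball (X j) (\<rho> j))"
  have G: "ball c (\<rho>0 i c) \<subseteq> G" if "c \<in> C i" for i c
  proof -
    have "(i, c) \<in> p ` J" using that by (simp add: p)
    then obtain j where "j \<in> J" "p j = (i, c)" by force
    then show ?thesis unfolding G_def X_def \<rho>_def by force
  qed
  obtain B where B: "0 \<le> B"
    "\<And>(x :: (real ^ 'd) \<times> real) y. 0 < snd x \<Longrightarrow> 2 \<le> norm x \<Longrightarrow>
      \<bar>modified_poisson_kernel m x y\<bar> * (1 + norm y ^ (n + m)) \<le>
        B * (snd x * norm x ^ m) * min 1 ((1 + norm y) / norm x) +
        B * (snd x * norm x ^ (n + m)) *
          (if norm x / 2 < norm y \<and> norm y \<le> 2 * norm x then 1 / norm (x - (y, 0)) ^ n else 0)"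
    unfolding dim by (rule modified_poisson_kernel_bound[where 'd = 'd and m = m]) blast
  define \<psi> where "\<psi> i = (\<integral>y. min 1 ((1 + norm y) / 2 ^ i) \<partial>M)" for i :: nat
  have \<psi>: "\<psi> \<longlonglongrightarrow> 0"
    unfolding \<psi>_def by (rule integral_min_dilation_tendsto_0[OF norm_meas]) simp
  define K where "K = 2 powr \<beta> / (1 - 2 powr - \<alpha>)"
  have K: "0 \<le> K" using \<alpha> powr_less_one[of 2 "- \<alpha>"] by (simp add: K_def)
  have bound: "\<bar>v x\<bar> \<le> (B * \<psi> i + B * K * e i) * (snd x powr (1 - \<alpha>) * norm x powr (real m + \<alpha>))"
    if x: "x \<in> S i" "x \<notin> G" and i: "1 \<le> i" for x i
  proof -
    define u where "u = snd x"
    define R where "R = norm x"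
    have "(2::real) ^ 1 \<le> 2 ^ i" using i by (intro power_increasing) auto
    also have iR: "\<dots> \<le> R" using x by (simp add: S_def R_def)
    finally have R: "2 \<le> R" by simp
    have u: "0 < u" "u \<le> R"
      using x norm_snd_le[of "snd x" "fst x"] by (auto simp: S_def upper_half_space_def u_def R_def)
    have xC: "x \<notin> (\<Union>c\<in>C i. ball c (\<rho>0 i c))" using G x by blast
    \<comment> \<open>The growth condition at \<open>x\<close> is the hypothesis of the layer
      estimate with constant \<open>c = e i * R powr (- \<beta>)\<close> and smallest distance
      \<open>u\<close>.\<close>
    define T where "T = K * (e i * R powr - \<beta> * u powr - \<alpha>)"
    have T: "(\<integral>\<^sup>+y. ennreal (1 / dist x (\<phi> y) ^ n) * indicator (A i) y \<partial>M) \<le> ennreal T"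
      unfolding T_def K_def \<beta>_def
    proof (rule nn_integral_inverse_power_le_of_growth[OF A _ u(1) _ \<alpha>(1)])
      show "(\<lambda>y. dist x (\<phi> y)) \<in> borel_measurable M" using \<phi>_meas by measurable
      show "u \<le> dist x (\<phi> y)" for y
        using norm_diff_boundary_ge(3)[of x y] u by (simp add: dist_norm \<phi>_def u_def)
      show "0 \<le> e i * R powr - (real n - \<alpha>)" using e(1)[of i] by simp
      fix r :: real assume r: "0 < r"
      have "measure M {y\<in>A i. dist x (\<phi> y) < r} \<le> e i * (r / R) powr \<beta>"
        unfolding R_def by (rule growth[OF x(1) xC r])
      also have "\<dots> = e i * R powr - (real n - \<alpha>) * r powr (real n - \<alpha>)"
        using r R unfolding \<beta>_def[symmetric] by (simp add: powr_divide powr_minus_divide)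
      finally show "emeasure M {y\<in>A i. dist x (\<phi> y) < r} \<le>
          ennreal (e i * R powr - (real n - \<alpha>) * r powr (real n - \<alpha>))"
        by (simp add: emeasure_eq_measure ennreal_leI)
    qed
    have T0: "0 \<le> T" using K e(1)[of i] by (simp add: T_def)
    have "\<bar>\<integral>y. modified_poisson_kernel m x y * f y \<partial>lebesgue\<bar> \<le>
        B * (u * R ^ m) * (\<integral>y. min 1 ((1 + norm y) / 2 ^ i) \<partial>M) + B * (u * R ^ (n + m)) * T"
      unfolding M_def
    proof (rule boundary_integral_bound[OF meas, where A = "A i" and g = "\<lambda>y. 1 / dist x (\<phi> y) ^ n"])
      fix y :: "real ^ 'd"
      have "min 1 ((1 + norm y) / R) \<le> min 1 ((1 + norm y) / 2 ^ i)"
        using iR R by (intro min.mono divide_left_mono) auto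
      moreover have "(if R / 2 < norm y \<and> norm y \<le> 2 * R then 1 / norm (x - (y, 0)) ^ n else 0)
          \<le> 1 / dist x (\<phi> y) ^ n * indicator (A i) y"
        using x iR by (auto simp: A_def M_def S_def R_def dist_norm \<phi>_def)
      ultimately show "\<bar>modified_poisson_kernel m x y\<bar> * (1 + norm y ^ (n + m)) \<le>
          B * (u * R ^ m) * min 1 ((1 + norm y) / 2 ^ i) +
          B * (u * R ^ (n + m)) * (1 / dist x (\<phi> y) ^ n * indicator (A i) y)"
        using B(1) u R
        by (intro order_trans[OF B(2)[of x y, folded u_def R_def]] add_mono mult_left_mono) auto
    next
      show "0 \<le> B * (u * R ^ m)" "0 \<le> B * (u * R ^ (n + m))" using B(1) u R by auto
    qed (use finite_M A T T0 norm_meas \<phi>_meas in \<open>auto simp: M_def\<close>)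
    then have v_le: "\<bar>v x\<bar> \<le> B * \<psi> i * (u * R ^ m) + B * (u * R ^ (n + m)) * T"
      using v[of x] x by (simp add: \<psi>_def S_def mult_ac)
    \<comment> \<open>The harmless part is of order \<open>x\<^sub>n \<bar>x\<bar> ^ m\<close>,
      which the target dominates since \<open>x\<^sub>n \<le> \<bar>x\<bar>\<close> and
      \<open>\<alpha> > 0\<close>.\<close>
    have "u * R ^ m \<le> u powr (1 - \<alpha>) * R powr (real m + \<alpha>)"
    proof -
      have "u * R ^ m = u powr (1 - \<alpha>) * (u powr \<alpha> * R powr real m)"
        using u R by (simp add: powr_realpow flip: powr_add mult.assoc)
      also have "\<dots> \<le> u powr (1 - \<alpha>) * (R powr \<alpha> * R powr real m)"
        using u R \<alpha> by (intro mult_left_mono mult_right_mono powr_mono2) auto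
      finally show ?thesis using R by (simp add: powr_add mult_ac)
    qed
    then have far: "B * \<psi> i * (u * R ^ m) \<le> B * \<psi> i * (u powr (1 - \<alpha>) * R powr (real m + \<alpha>))"
      using B(1) by (intro mult_left_mono) (auto simp: \<psi>_def intro!: integral_nonneg_AE)
    have near: "B * (u * R ^ (n + m)) * T = B * K * e i * (u powr (1 - \<alpha>) * R powr (real m + \<alpha>))"
    proof -
      have 1: "u * u powr - \<alpha> = u powr (1 - \<alpha>)"
        using u by (simp add: powr_diff powr_minus divide_inverse)
      have 2: "R ^ (n + m) * R powr - \<beta> = R powr (real m + \<alpha>)"
        using R by (simp add: \<beta>_def flip: powr_realpow powr_add)
      show ?thesis unfolding T_def 1[symmetric] 2[symmetric] by (simp add: mult_ac)
    qed
    show ?thesis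
      using v_le far unfolding near distrib_right u_def[symmetric] R_def[symmetric] by linarith
  qed
  have "(\<lambda>i. B * \<psi> i + B * K * e i) \<longlonglongrightarrow> B * 0 + B * K * 0"
    by (intro tendsto_intros \<psi> e(3))
  then have lim: "(\<lambda>i. B * \<psi> i + B * K * e i) \<longlonglongrightarrow> 0" by simp
  have "v \<in> o[inf at_infinity (principal (upper_half_space - G))](\<lambda>x.
      snd x powr (1 - \<alpha>) * norm x powr (real m + \<alpha>))"
  proof (rule landau_o.smallI)
    fix c :: real assume "0 < c"
    with lim have "\<forall>\<^sub>F i in sequentially. B * \<psi> i + B * K * e i < c"
      by (rule order_tendstoD(2))
    then obtain i0 where i0: "\<And>i. i0 \<le> i \<Longrightarrow> B * \<psi> i + B * K * e i < c"
      by (auto simp: eventually_sequentially)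
    have "norm (v x) \<le> c * norm (snd x powr (1 - \<alpha>) * norm x powr (real m + \<alpha>))"
      if x: "2 ^ Suc i0 \<le> norm x" "x \<in> upper_half_space - G" for x
    proof -
      obtain k0 where k0: "norm x < 2 ^ k0" using real_arch_pow[of 2 "norm x"] by auto
      \<comment> \<open>The dyadic shell that contains \<open>x\<close> is found from above:
        \<open>k\<close> is the index of its outer radius.\<close>
      define k where "k = (LEAST k. norm x < 2 ^ k)"
      have k: "norm x < 2 ^ k" unfolding k_def by (rule LeastI[of _ k0]) (rule k0)
      with x(1) have "(2::real) ^ Suc i0 < 2 ^ k" by linarith
      then have "Suc i0 < k" by (rule power_less_imp_less_exp[rotated]) simp
      then obtain i where i: "k = Suc i" "Suc i0 \<le> i" by (cases k) auto
      have "2 ^ i \<le> norm x"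
        using not_less_Least[of i "\<lambda>k. norm x < 2 ^ k"] i unfolding k_def[symmetric] by simp
      then have "x \<in> S i" using x k i by (simp add: S_def)
      then have "\<bar>v x\<bar> \<le> (B * \<psi> i + B * K * e i) * (snd x powr (1 - \<alpha>) * norm x powr (real m + \<alpha>))"
        using x i by (intro bound) auto
      also have "\<dots> \<le> c * (snd x powr (1 - \<alpha>) * norm x powr (real m + \<alpha>))"
        using i0[of i] i by (intro mult_right_mono) auto
      finally show ?thesis by simp
    qed
    then show "\<forall>\<^sub>F x in inf at_infinity (principal (upper_half_space - G)).
        norm (v x) \<le> c * norm (snd x powr (1 - \<alpha>) * norm x powr (real m + \<alpha>))"
      unfolding eventually_inf_principal eventually_at_infinity by blast
  qed
  moreover have "\<forall>j\<in>J. X j \<in> upper_half_space \<and> \<rho> j > 0"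
    using pC C(2,3) unfolding X_def \<rho>_def S_def by blast
  moreover have "(\<lambda>j. \<rho> j powr (real n - \<alpha>) / norm (X j) powr (real n - \<alpha>)) summable_on J"
    using J_sum by (simp add: X_def \<rho>_def \<beta>_def)
  ultimately show ?thesis unfolding G_def by blast
qed

end
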